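(* Every $5\times 5$ non-consecutive Latin square is also a toroidal non-consecutive Latin square and a modular non-consecutive Latin square.
   Context: A Latin square of order $n$ is an $n\times n$ table filled with the integers $1,\dots,n$ so that each integer appears exactly once in each row and in each column. Two integers are consecutive if they differ by exactly $1$. A non-consecutive Latin square is a Latin square in which no two orthogonally adjacent cells contain consecutive integers. It is toroidal non-consecutive if the same condition holds when the square is viewed as a torus, i.e. the left-most and right-most cells of each row are also considered adjacent, and the top-most and bottom-most cells of each column are also considered adjacent. It is modular non-consecutive if the non-consecutive condition holds when numbers are considered modulo $n$, i.e. $1$ and $n$ are also considered consecutive. *)

theory Defs
  imports Main
begin

definition cells :: "nat \<Rightarrow> (nat \<times> nat) set" where
  "cells n = {1..n} \<times> {1..n}"

(* A table is a function from (row, column) to entries; only its values on cells n matter. *)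
definition latin_square :: "nat \<Rightarrow> (nat \<times> nat \<Rightarrow> nat) \<Rightarrow> bool" where
  "latin_square n L \<longleftrightarrow>
     (\<forall>c\<in>cells n. L c \<in> {1..n}) \<and>
     (\<forall>k\<in>{1..n}. \<forall>i\<in>{1..n}. \<exists>!j. j \<in> {1..n} \<and> L (i, j) = k) \<and>
     (\<forall>k\<in>{1..n}. \<forall>j\<in>{1..n}. \<exists>!i. i \<in> {1..n} \<and> L (i, j) = k)"

definition consecutive :: "nat \<Rightarrow> nat \<Rightarrow> bool" where
  "consecutive a b \<longleftrightarrow> a = b + 1 \<or> b = a + 1"

(* Consecutive modulo n, for numbers a and b represented in {1..n}. *)
definition mod_consecutive :: "nat \<Rightarrow> nat \<Rightarrow> nat \<Rightarrow> bool" where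
  "mod_consecutive n a b \<longleftrightarrow> consecutive a b \<or> (a = 1 \<and> b = n) \<or> (a = n \<and> b = 1)"

definition adjacent :: "nat \<times> nat \<Rightarrow> nat \<times> nat \<Rightarrow> bool" where
  "adjacent c d \<longleftrightarrow>
     (fst c = fst d \<and> consecutive (snd c) (snd d)) \<or>
     (snd c = snd d \<and> consecutive (fst c) (fst d))"

definition torus_adjacent :: "nat \<Rightarrow> nat \<times> nat \<Rightarrow> nat \<times> nat \<Rightarrow> bool" where
  "torus_adjacent n c d \<longleftrightarrow>
     adjacent c d \<or>
     (fst c = fst d \<and> ((snd c = 1 \<and> snd d = n) \<or> (snd c = n \<and> snd d = 1))) \<or>
     (snd c = snd d \<and> ((fst c = 1 \<and> fst d = n) \<or> (fst c = n \<and> fst d = 1)))"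

definition nonconsecutive_latin_square :: "nat \<Rightarrow> (nat \<times> nat \<Rightarrow> nat) \<Rightarrow> bool" where
  "nonconsecutive_latin_square n L \<longleftrightarrow>
     latin_square n L \<and>
     (\<forall>c\<in>cells n. \<forall>d\<in>cells n. adjacent c d \<longrightarrow> \<not> consecutive (L c) (L d))"

definition toroidal_nonconsecutive_latin_square :: "nat \<Rightarrow> (nat \<times> nat \<Rightarrow> nat) \<Rightarrow> bool" where
  "toroidal_nonconsecutive_latin_square n L \<longleftrightarrow>
     latin_square n L \<and>
     (\<forall>c\<in>cells n. \<forall>d\<in>cells n. torus_adjacent n c d \<longrightarrow> \<not> consecutive (L c) (L d))"

(* Only the numbers wrap around here; adjacency of cells is that of the plane. *)
definition modular_nonconsecutive_latin_square :: "nat \<Rightarrow> (nat \<times> nat \<Rightarrow> nat) \<Rightarrow> bool" where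
  "modular_nonconsecutive_latin_square n L \<longleftrightarrow>
     latin_square n L \<and>
     (\<forall>c\<in>cells n. \<forall>d\<in>cells n. adjacent c d \<longrightarrow> \<not> mod_consecutive n (L c) (L d))"

end

theory Submission
  imports Defs
begin

text \<open>
  The pairs of distinct non-consecutive integers in \<open>{1..5}\<close> are the edges \<open>{a, a + 2}\<close> modulo 5,
  which form a 5-cycle, and the chord \<open>{1, 5}\<close>. If 1 faces 5 in two neighbouring rows (or
  columns), these are one of eight ordered pairs, such as 24135 and 42513, and no third row fits
  on either side; so the chord is never used and the square is modular. Each row and column is
  then a Hamiltonian path in the 5-cycle, whose ends are joined by the remaining edge; so the
  square is toroidal.
\<close>

text \<open>Range inclusion and injectivity together make a line a permutation of
  \<open>{1..n}\<close>. A function of one index serves for rows and, after transposition, for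
  columns.\<close>

definition nonconsecutive_line :: "nat \<Rightarrow> (nat \<Rightarrow> nat) \<Rightarrow> bool" where
  "nonconsecutive_line n f \<longleftrightarrow>
     f ` {1..n} \<subseteq> {1..n} \<and> inj_on f {1..n} \<and>
     (\<forall>i\<in>{1..n}. \<forall>j\<in>{1..n}. consecutive i j \<longrightarrow> \<not> consecutive (f i) (f j))"

definition neighbouring_lines :: "nat \<Rightarrow> (nat \<Rightarrow> nat) \<Rightarrow> (nat \<Rightarrow> nat) \<Rightarrow> bool" where
  "neighbouring_lines n f g \<longleftrightarrow>
     (\<forall>j\<in>{1..n}. f j \<noteq> g j \<and> \<not> consecutive (f j) (g j))"

lemma atLeastAtMost_1_5: "{1..5} = {1, 2, 3, 4, 5::nat}"
  by auto

text \<open>These are the directed Hamiltonian paths of the 5-cycle 1-3-5-2-4 with the chord 1-5: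
  ten along the cycle alone, and four through the chord, namely 24153, 31524 and their
  reversals.\<close>

lemma nonconsecutive_line_5_cases:
  assumes "nonconsecutive_line 5 f"
  shows "[f 1, f 2, f 3, f 4, f 5] \<in>
    {[1,3,5,2,4], [1,4,2,5,3], [2,4,1,3,5], [2,4,1,5,3], [2,5,3,1,4], [3,1,4,2,5], [3,1,5,2,4],
     [3,5,1,4,2], [3,5,2,4,1], [4,1,3,5,2], [4,2,5,1,3], [4,2,5,3,1], [5,2,4,1,3], [5,3,1,4,2]}"
proof -
  have mem: "f i \<in> {1, 2, 3, 4, 5}" if "i \<in> {1..5}" for i
    using assms that unfolding nonconsecutive_line_def atLeastAtMost_1_5 by blast
  have range: "f 1 \<in> {1, 2, 3, 4, 5}" "f 2 \<in> {1, 2, 3, 4, 5}" "f 3 \<in> {1, 2, 3, 4, 5}"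
    "f 4 \<in> {1, 2, 3, 4, 5}" "f 5 \<in> {1, 2, 3, 4, 5}"
    by (rule mem; simp)+
  have distinct: "f 1 \<noteq> f 2" "f 1 \<noteq> f 3" "f 1 \<noteq> f 4" "f 1 \<noteq> f 5" "f 2 \<noteq> f 3" "f 2 \<noteq> f 4"
    "f 2 \<noteq> f 5" "f 3 \<noteq> f 4" "f 3 \<noteq> f 5" "f 4 \<noteq> f 5"
    using assms by (simp_all add: nonconsecutive_line_def inj_on_eq_iff[of f "{1..5}"])
  have adj: "\<not> consecutive (f i) (f j)" if "consecutive i j" "i \<in> {1..5}" "j \<in> {1..5}" for i j
    using assms that by (simp add: nonconsecutive_line_def)
  have step: "\<not> consecutive (f 1) (f 2)" "\<not> consecutive (f 2) (f 3)"
    "\<not> consecutive (f 3) (f 4)" "\<not> consecutive (f 4) (f 5)"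
    by (rule adj; simp add: consecutive_def)+
  \<comment> \<open>Prefixes are extended by one entry at a time and pruned to 12, 18 and 20
    survivors, so no stage splits into more than 100 cases.\<close>
  have ab: "[f 1, f 2] \<in> {[1,3], [1,4], [1,5], [2,4], [2,5], [3,1], [3,5], [4,1], [4,2],
      [5,1], [5,2], [5,3]}"
    using range(1,2) distinct(1) step(1)
    by (elim insertE emptyE) (simp_all add: consecutive_def)
  have abc: "[f 1, f 2, f 3] \<in> {[1,3,5], [1,4,2], [1,5,2], [1,5,3], [2,4,1], [2,5,1], [2,5,3],
      [3,1,4], [3,1,5], [3,5,1], [3,5,2], [4,1,3], [4,1,5], [4,2,5], [5,1,3], [5,1,4], [5,2,4],
      [5,3,1]}"
    using ab range(3) distinct(2,5) step(2)
    by (elim insertE emptyE) (simp_all add: consecutive_def)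
  have "[f 1, f 2, f 3, f 4] \<in> {[1,3,5,2], [1,4,2,5], [1,5,2,4], [2,4,1,3], [2,4,1,5],
      [2,5,1,3], [2,5,1,4], [2,5,3,1], [3,1,4,2], [3,1,5,2], [3,5,1,4], [3,5,2,4], [4,1,3,5],
      [4,1,5,2], [4,1,5,3], [4,2,5,1], [4,2,5,3], [5,1,4,2], [5,2,4,1], [5,3,1,4]}"
    using abc range(4) distinct(3,6,8) step(3)
    by (elim insertE emptyE) (simp_all add: consecutive_def)
  then show ?thesis
    using range(5) distinct(4,7,9,10) step(4)
    by (elim insertE emptyE) (simp_all add: consecutive_def)
qed

text \<open>Exhaustive search over pairs of listed lines. Up to reversing both lines, replacing each
  entry \<open>a\<close> by \<open>6 - a\<close>, and swapping the two lines, only the pair 24135,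
  42513 survives.\<close>

lemma neighbouring_lines_1_5_cases:
  assumes "nonconsecutive_line 5 f" "nonconsecutive_line 5 g" "neighbouring_lines 5 f g"
    and "j \<in> {1..5}" "{f j, g j} = {1, 5}"
  shows "([f 1, f 2, f 3, f 4, f 5], [g 1, g 2, g 3, g 4, g 5]) \<in>
    {([2,4,1,3,5], [4,2,5,1,3]), ([2,4,1,5,3], [4,2,5,3,1]),
     ([3,1,5,2,4], [5,3,1,4,2]), ([3,5,1,4,2], [1,3,5,2,4]),
     ([4,2,5,1,3], [2,4,1,3,5]), ([4,2,5,3,1], [2,4,1,5,3]),
     ([5,3,1,4,2], [3,1,5,2,4]), ([1,3,5,2,4], [3,5,1,4,2])}"
  using nonconsecutive_line_5_cases[OF assms(1)] nonconsecutive_line_5_cases[OF assms(2)]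
    assms(3-5)
  unfolding neighbouring_lines_def atLeastAtMost_1_5
  by (elim insertE emptyE) (simp_all add: consecutive_def doubleton_eq_iff)

text \<open>If \<open>f\<close> is 24135 and \<open>g\<close> is 42513, then \<open>h\<close> would
  need the entry 1 in both the first and the fifth position; if they are swapped, it would need 5 in
  both the first and the fourth. The other six pairs are symmetric to these.\<close>

lemma no_1_5_of_three_lines:
  assumes "nonconsecutive_line 5 f" "nonconsecutive_line 5 g" "nonconsecutive_line 5 h"
    and "neighbouring_lines 5 f g" "neighbouring_lines 5 g h"
    and "\<forall>j\<in>{1..5}. f j \<noteq> h j" and "j \<in> {1..5}"
  shows "{f j, g j} \<noteq> {1, 5}"
proof
  assume "{f j, g j} = {1, 5}"
  from neighbouring_lines_1_5_cases[OF assms(1,2,4,7) this]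
    nonconsecutive_line_5_cases[OF assms(3)] assms(5,6)
  show False
    unfolding neighbouring_lines_def atLeastAtMost_1_5
    by (elim insertE emptyE) (simp_all add: consecutive_def)
qed

text \<open>The listed lines with consecutive ends are exactly the four that use the chord 1-5, and
  the second hypothesis excludes those.\<close>

lemma nonconsecutive_line_5_ends:
  assumes "nonconsecutive_line 5 f"
    and "\<forall>i\<in>{1..5}. \<forall>j\<in>{1..5}. consecutive i j \<longrightarrow> \<not> mod_consecutive 5 (f i) (f j)"
  shows "\<not> consecutive (f 1) (f 5)"
proof -
  have "\<not> mod_consecutive 5 (f 1) (f 2)" "\<not> mod_consecutive 5 (f 2) (f 3)"
    "\<not> mod_consecutive 5 (f 3) (f 4)" "\<not> mod_consecutive 5 (f 4) (f 5)"
    by (rule assms(2)[rule_format]; simp add: consecutive_def)+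
  with nonconsecutive_line_5_cases[OF assms(1)] show ?thesis
    by (elim insertE emptyE) (simp_all add: consecutive_def mod_consecutive_def)
qed

lemma consecutive_commute: "consecutive a b \<longleftrightarrow> consecutive b a"
  by (auto simp: consecutive_def)

text \<open>Rows and columns play symmetric roles, so each result below need only be proved in one
  direction.\<close>

lemma nonconsecutive_latin_square_transpose:
  assumes "nonconsecutive_latin_square n L"
  shows "nonconsecutive_latin_square n (\<lambda>(i, j). L (j, i))"
  using assms unfolding nonconsecutive_latin_square_def latin_square_def adjacent_def cells_def
  by auto

lemma latin_square_row_inj:
  assumes "latin_square n L" "i \<in> {1..n}"
  shows "inj_on (\<lambda>j. L (i, j)) {1..n}"
proof (rule inj_onI)
  fix j j' assume j: "j \<in> {1..n}" "j' \<in> {1..n}" "L (i, j) = L (i, j')"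
  then have "L (i, j) \<in> {1..n}"
    using assms by (auto simp: latin_square_def cells_def)
  with assms have "\<exists>!j'. j' \<in> {1..n} \<and> L (i, j') = L (i, j)"
    by (auto simp: latin_square_def)
  with j show "j = j'" by metis
qed

lemma nonconsecutive_latin_square_row:
  assumes "nonconsecutive_latin_square n L" "i \<in> {1..n}"
  shows "nonconsecutive_line n (\<lambda>j. L (i, j))"
  using assms latin_square_row_inj[of n L i]
  unfolding nonconsecutive_line_def nonconsecutive_latin_square_def
  by (auto simp: latin_square_def cells_def adjacent_def)

lemma nonconsecutive_latin_square_column_inj:
  assumes "nonconsecutive_latin_square n L" "j \<in> {1..n}" "i \<in> {1..n}" "i' \<in> {1..n}" "i \<noteq> i'"
  shows "L (i, j) \<noteq> L (i', j)"
proof -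
  have "inj_on (\<lambda>i. L (i, j)) {1..n}"
    using nonconsecutive_latin_square_row[OF nonconsecutive_latin_square_transpose[OF assms(1)]
      assms(2)]
    by (simp add: nonconsecutive_line_def)
  from inj_onD[OF this _ assms(3,4)] assms(5) show ?thesis by blast
qed

lemma nonconsecutive_latin_square_neighbouring_rows:
  assumes "nonconsecutive_latin_square n L" "i \<in> {1..n}" "i' \<in> {1..n}" "consecutive i i'"
  shows "neighbouring_lines n (\<lambda>j. L (i, j)) (\<lambda>j. L (i', j))"
  unfolding neighbouring_lines_def
proof (intro ballI conjI)
  fix j assume j: "j \<in> {1..n}"
  have "i \<noteq> i'" using assms(4) by (auto simp: consecutive_def)
  with assms(1-3) j show "L (i, j) \<noteq> L (i', j)"
    using nonconsecutive_latin_square_column_inj by blast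
  have "adjacent (i, j) (i', j)" using assms(4) by (simp add: adjacent_def)
  with assms(1-3) j show "\<not> consecutive (L (i, j)) (L (i', j))"
    by (auto simp: nonconsecutive_latin_square_def cells_def simp del: atLeastAtMost_iff)
qed

lemma no_vertical_1_5:
  assumes L: "nonconsecutive_latin_square 5 L"
    and i: "i \<in> {1..5}" "i' \<in> {1..5}" "consecutive i i'" and j: "j \<in> {1..5}"
  shows "{L (i, j), L (i', j)} \<noteq> {1, 5}"
proof -
  \<comment> \<open>Row \<open>k\<close> lies beyond \<open>b\<close>, on the side away from
    \<open>a\<close>.\<close>
  have third: "{L (a, j), L (b, j)} \<noteq> {1, 5}"
    if "a \<in> {1..5}" "b \<in> {1..5}" "k \<in> {1..5}" "consecutive a b" "consecutive b k" "a \<noteq> k"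
    for a b k
  proof (rule no_1_5_of_three_lines[OF _ _ _ _ _ _ j])
    show "nonconsecutive_line 5 (\<lambda>j. L (a, j))" "nonconsecutive_line 5 (\<lambda>j. L (b, j))"
      "nonconsecutive_line 5 (\<lambda>j. L (k, j))"
      using nonconsecutive_latin_square_row[OF L] that(1-3) by blast+
    show "neighbouring_lines 5 (\<lambda>j. L (a, j)) (\<lambda>j. L (b, j))"
      "neighbouring_lines 5 (\<lambda>j. L (b, j)) (\<lambda>j. L (k, j))"
      using nonconsecutive_latin_square_neighbouring_rows[OF L] that(1-5) by blast+
    show "\<forall>j\<in>{1..5}. L (a, j) \<noteq> L (k, j)"
      using nonconsecutive_latin_square_column_inj[OF L _ that(1,3,6)] by blast
  qed
  \<comment> \<open>Two neighbouring rows cannot be both the first and the last of five, so a third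
    row exists beyond one of them. If it lies beyond \<open>i\<close>, the pair is read in reverse
    order.\<close>
  have "(\<exists>k\<in>{1..5}. consecutive i' k \<and> i \<noteq> k) \<or> (\<exists>k\<in>{1..5}. consecutive i k \<and> i' \<noteq> k)"
    using i unfolding atLeastAtMost_1_5 by (auto simp: consecutive_def)
  moreover have "consecutive i' i" using i(3) consecutive_commute by blast
  ultimately show ?thesis
    using third[OF i(1,2)] third[OF i(2,1)] i(3) insert_commute[of "L (i, j)" "L (i', j)"] by metis
qed

lemma not_mod_consecutive_vertical:
  assumes L: "nonconsecutive_latin_square 5 L"
    and "i \<in> {1..5}" "i' \<in> {1..5}" "consecutive i i'" "j \<in> {1..5}"
  shows "\<not> mod_consecutive 5 (L (i, j)) (L (i', j))"
  using no_vertical_1_5[OF assms] nonconsecutive_latin_square_neighbouring_rows[OF assms(1-4)]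
    assms(5)
  by (auto simp: mod_consecutive_def neighbouring_lines_def)

lemma not_mod_consecutive_horizontal:
  assumes L: "nonconsecutive_latin_square 5 L"
    and "j \<in> {1..5}" "j' \<in> {1..5}" "consecutive j j'" "i \<in> {1..5}"
  shows "\<not> mod_consecutive 5 (L (i, j)) (L (i, j'))"
  using not_mod_consecutive_vertical[OF nonconsecutive_latin_square_transpose[OF L] assms(2-5)]
  by simp

lemma row_ends_not_consecutive:
  assumes L: "nonconsecutive_latin_square 5 L" and i: "i \<in> {1..5}"
  shows "\<not> consecutive (L (i, 1)) (L (i, 5))"
  using nonconsecutive_line_5_ends[OF nonconsecutive_latin_square_row[OF L i]]
    not_mod_consecutive_horizontal[OF L _ _ _ i]
  by blast

lemma column_ends_not_consecutive:
  assumes L: "nonconsecutive_latin_square 5 L" and j: "j \<in> {1..5}"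
  shows "\<not> consecutive (L (1, j)) (L (5, j))"
  using row_ends_not_consecutive[OF nonconsecutive_latin_square_transpose[OF L] j] by simp

theorem corollary2:
  fixes L :: "nat \<times> nat \<Rightarrow> nat"
  assumes "nonconsecutive_latin_square 5 L"
  shows "toroidal_nonconsecutive_latin_square 5 L \<and> modular_nonconsecutive_latin_square 5 L"
proof
  show "toroidal_nonconsecutive_latin_square 5 L"
    unfolding toroidal_nonconsecutive_latin_square_def
  proof (intro conjI ballI impI)
    show "latin_square 5 L" using assms by (simp add: nonconsecutive_latin_square_def)
  next
    fix c d assume c: "c \<in> cells 5" and d: "d \<in> cells 5" and "torus_adjacent 5 c d"
    \<comment> \<open>Plane adjacency is covered by the assumption, wrap-around by the two lemmas on
      ends; symmetry of \<open>consecutive\<close> handles the order from 5 to 1.\<close>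
    then show "\<not> consecutive (L c) (L d)"
      using assms row_ends_not_consecutive[OF assms, of "fst c"]
        column_ends_not_consecutive[OF assms, of "snd c"]
      unfolding torus_adjacent_def nonconsecutive_latin_square_def cells_def
      by (cases c; cases d) (auto simp: consecutive_commute)
  qed
  show "modular_nonconsecutive_latin_square 5 L"
    unfolding modular_nonconsecutive_latin_square_def
  proof (intro conjI ballI impI)
    show "latin_square 5 L" using assms by (simp add: nonconsecutive_latin_square_def)
  next
    fix c d assume "c \<in> cells 5" "d \<in> cells 5" "adjacent c d"
    then show "\<not> mod_consecutive 5 (L c) (L d)"
      using not_mod_consecutive_vertical[OF assms] not_mod_consecutive_horizontal[OF assms]
      unfolding adjacent_def cells_def by (cases c; cases d) auto
  qed
qed

end
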